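(* Let $G$ be a finite group of order $n$ with identity $e$, and let $S\subseteq G\setminus\{e\}$ satisfy $S=S^{-1}$, $G=\langle S\rangle$ and $|S|=n-3$. Then $\gamma_{S}(\mathrm{Cay}(S:G))=3$ if $n$ is odd, and $\gamma_{S}(\mathrm{Cay}(S:G))=4$ if $n$ is even.
   Context: $\mathrm{Cay}(S:G)$ is the simple graph with vertex set $G$ in which $a$ and $b$ are adjacent if and only if $ab^{-1}\in S$. For a graph $\Gamma$, $N[v]$ denotes the closed neighborhood of $v$ (the vertex $v$ together with all its neighbors). A signed dominating function of $\Gamma$ is a function $g:V(\Gamma)\to\{-1,1\}$ with $\sum_{u\in N[v]}g(u)>0$ for every $v\in V(\Gamma)$; its weight is $\sum_{v\in V(\Gamma)}g(v)$. The signed domination number $\gamma_{S}(\Gamma)$ is the minimum weight of a signed dominating function of $\Gamma$ (the subscript $S$ in $\gamma_S$ is part of the notation and unrelated to the set $S$). *)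

theory Defs
  imports "HOL-Algebra.Generated_Groups" "Graph_Theory.Pair_Digraph"
begin

(* As in the library locale pair_graph, a finite simple graph is a loop-free digraph with a
   symmetric arc relation.  For arbitrary S the Cayley graph below is only a digraph; lemma
   pair_graph_Cay shows that it is a simple graph when S is inverse-closed and omits the
   identity. *)
definition Cay :: "'a set \<Rightarrow> ('a, 'b) monoid_scheme \<Rightarrow> 'a pair_pre_digraph" where
  "Cay S G = \<lparr> pverts = carrier G,
     parcs = {(a, b). a \<in> carrier G \<and> b \<in> carrier G \<and> a \<otimes>\<^bsub>G\<^esub> inv\<^bsub>G\<^esub> b \<in> S} \<rparr>"

definition closed_nbhd :: "'a pair_pre_digraph \<Rightarrow> 'a \<Rightarrow> 'a set" where
  "closed_nbhd \<Gamma> v = insert v {u \<in> pverts \<Gamma>. (v, u) \<in> parcs \<Gamma>}"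

definition signed_dominating :: "'a pair_pre_digraph \<Rightarrow> ('a \<Rightarrow> int) \<Rightarrow> bool" where
  "signed_dominating \<Gamma> g \<longleftrightarrow>
     g \<in> pverts \<Gamma> \<rightarrow>\<^sub>E {-1, 1} \<and> (\<forall>v\<in>pverts \<Gamma>. (\<Sum>u\<in>closed_nbhd \<Gamma> v. g u) > 0)"

definition weight :: "'a pair_pre_digraph \<Rightarrow> ('a \<Rightarrow> int) \<Rightarrow> int" where
  "weight \<Gamma> g = (\<Sum>v\<in>pverts \<Gamma>. g v)"

(* For a finite graph the minimum is taken over a finite nonempty set, by
   finite_signed_dominating and ex_signed_dominating. *)
definition signed_domination_number :: "'a pair_pre_digraph \<Rightarrow> int" where
  "signed_domination_number \<Gamma> = Min {weight \<Gamma> g | g. signed_dominating \<Gamma> g}"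

lemma pair_graph_Cay:
  assumes "group G" "finite (carrier G)" "S \<subseteq> carrier G - {\<one>\<^bsub>G\<^esub>}" "S = set_inv\<^bsub>G\<^esub> S"
  shows "pair_graph (Cay S G)"
proof -
  interpret group G by fact
  have sym: "b \<otimes>\<^bsub>G\<^esub> inv\<^bsub>G\<^esub> a \<in> S"
    if "a \<in> carrier G" "b \<in> carrier G" "a \<otimes>\<^bsub>G\<^esub> inv\<^bsub>G\<^esub> b \<in> S" for a b
  proof -
    have "inv\<^bsub>G\<^esub> (a \<otimes>\<^bsub>G\<^esub> inv\<^bsub>G\<^esub> b) \<in> set_inv\<^bsub>G\<^esub> S"
      using that by (auto simp: SET_INV_def)
    then show ?thesis using that assms(4) by (simp add: inv_mult_group)
  qed
  have "parcs (Cay S G) \<subseteq> carrier G \<times> carrier G" by (auto simp: Cay_def)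
  then have fin: "finite (parcs (Cay S G))" using assms(2) by (meson finite_SigmaI finite_subset)
  show ?thesis
  proof unfold_locales
    show "finite (parcs (Cay S G))" by (rule fin)
    have "Relation.sym (parcs (Cay S G))" using sym by (auto simp: sym_def Cay_def)
    then show "symmetric (with_proj (Cay S G))" by (simp add: symmetric_def)
  qed (use assms in \<open>auto simp: Cay_def\<close>)
qed

lemma finite_signed_dominating:
  assumes "finite (pverts \<Gamma>)"
  shows "finite {weight \<Gamma> g | g. signed_dominating \<Gamma> g}"
proof -
  have "finite (pverts \<Gamma> \<rightarrow>\<^sub>E {-1, 1 :: int})" using assms by (simp add: finite_PiE)
  then have "finite {g. signed_dominating \<Gamma> g}"
    by (rule rev_finite_subset) (auto simp: signed_dominating_def)
  then show ?thesis by simp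
qed

lemma ex_signed_dominating:
  assumes "finite (pverts \<Gamma>)"
  shows "\<exists>g. signed_dominating \<Gamma> g"
proof -
  let ?g = "\<lambda>v\<in>pverts \<Gamma>. 1 :: int"
  have "(\<Sum>u\<in>closed_nbhd \<Gamma> v. ?g u) > 0" if "v \<in> pverts \<Gamma>" for v
    using assms that by (intro sum_pos) (auto simp: closed_nbhd_def)
  then show ?thesis by (intro exI[of _ ?g]) (auto simp: signed_dominating_def)
qed

end

(* The complement of a closed neighbourhood N[v] is the translate of a fixed two-element set T,
   so the sum of g over it is an even number d(v) \<le> 2, and \<Sum>v. d(v) = 2 w, where w is the weight
   of g.  Domination says d(v) < w for all v.  Hence every g with w \<ge> 3 dominates.  If w \<le> 2, then
   d(v) \<le> 0 by parity, so w \<le> 0; and then 2 w \<le> n (w - 1) \<le> 3 (w - 1) gives w \<ge> 3, a contradiction.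
   As w and n have the same parity, the minimum is 3 or 4. *)
theory Submission
  imports Defs
begin

text \<open>Every sign is odd. On the whole group this ties the parity of the weight to that of
  \<open>n\<close>; on the complement of a closed neighbourhood it makes the sum even.\<close>

lemma even_sum_signs_iff:
  fixes g :: "'a \<Rightarrow> int"
  assumes "finite A" "g \<in> A \<rightarrow> {-1, 1}"
  shows "even (sum g A) \<longleftrightarrow> even (card A)"
proof -
  have "odd (g a)" if "a \<in> A" for a using assms(2) that by (force simp: Pi_iff)
  then have "{a \<in> A. odd (g a)} = A" by blast
  then show ?thesis using assms(1) by (simp add: even_sum_iff)
qed

text \<open>Starting from the constant 1, each flip to -1 lowers the sum by 2, so flipping half of
  \<open>card A - k\<close> elements reaches \<open>k\<close>.\<close>

lemma ex_signs_with_sum: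
  assumes "finite A" "k \<le> card A" "even (card A - k)"
  shows "\<exists>g \<in> A \<rightarrow>\<^sub>E {-1, 1 :: int}. sum g A = int k"
proof -
  obtain m where m: "card A = k + 2 * m"
    using assms(2,3) by (metis dvdE le_add_diff_inverse)
  then obtain B where B: "B \<subseteq> A" "card B = m" "finite B"
    by (metis assms(1) finite_subset le_add2 mult_2 obtain_subset_with_card_n trans_le_add2)
  let ?g = "\<lambda>v\<in>A. if v \<in> B then - 1 else 1 :: int"
  have "sum ?g A = sum ?g (A - B) + sum ?g B"
    using assms(1) B(1) by (rule sum.subset_diff[rotated])
  also have "sum ?g (A - B) = (\<Sum>v\<in>A - B. 1)" by (rule sum.cong) auto
  also have "sum ?g B = (\<Sum>v\<in>B. - 1)" using B(1) by (intro sum.cong) auto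
  finally have "sum ?g A = int k" using B m by (simp add: card_Diff_subset)
  then show ?thesis by (intro bexI[of _ ?g]) auto
qed

text \<open>Put t = v u^-1, so that u = t^-1 v. Then u = v iff t = 1, and u is a neighbour of v iff
  t lies in S.\<close>

lemma (in group) Diff_closed_nbhd_Cay:
  assumes "v \<in> carrier G"
  shows "carrier G - closed_nbhd (Cay S G) v
    = (\<lambda>t. inv t \<otimes> v) ` (carrier G - insert \<one> S)"
proof (intro equalityI subsetI)
  fix u assume u: "u \<in> carrier G - closed_nbhd (Cay S G) v"
  have "v \<otimes> inv u \<noteq> \<one>"
    using u assms by (metis DiffE closed_nbhd_def insertI1 inv_closed inv_equality inv_inv)
  moreover have "v \<otimes> inv u \<notin> S" using u assms by (auto simp: closed_nbhd_def Cay_def)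
  moreover have "u = inv (v \<otimes> inv u) \<otimes> v" using u assms by (simp add: inv_mult_group m_assoc)
  ultimately show "u \<in> (\<lambda>t. inv t \<otimes> v) ` (carrier G - insert \<one> S)"
    using u assms by auto
next
  fix u assume "u \<in> (\<lambda>t. inv t \<otimes> v) ` (carrier G - insert \<one> S)"
  then obtain t where t: "t \<in> carrier G" "t \<noteq> \<one>" "t \<notin> S" "u = inv t \<otimes> v" by auto
  have "v \<otimes> inv u = t" using t assms by (simp add: inv_mult_group m_assoc[symmetric])
  moreover have "u \<noteq> v" using calculation t assms by auto
  ultimately show "u \<in> carrier G - closed_nbhd (Cay S G) v"
    using t assms by (auto simp: closed_nbhd_def Cay_def)
qed

lemma (in group) inj_on_inv_mult:
  assumes "v \<in> carrier G" "T \<subseteq> carrier G"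
  shows "inj_on (\<lambda>t. inv t \<otimes> v) T"
  using assms by (intro inj_onI) (metis inv_closed inv_inj inj_onD right_cancel subsetD)

lemma (in group) card_Diff_closed_nbhd_Cay:
  assumes "v \<in> carrier G"
  shows "card (carrier G - closed_nbhd (Cay S G) v) = card (carrier G - insert \<one> S)"
  by (simp add: Diff_closed_nbhd_Cay[OF assms] card_image inj_on_inv_mult[OF assms])

text \<open>Double counting: after swapping the sums, each fixed t contributes the full sum of
  \<open>g\<close>, because v \<mapsto> t^-1 v permutes the group.\<close>

lemma (in group) sum_sum_Diff_closed_nbhd_Cay:
  fixes g :: "'a \<Rightarrow> int"
  shows "(\<Sum>v\<in>carrier G. sum g (carrier G - closed_nbhd (Cay S G) v))
    = int (card (carrier G - insert \<one> S)) * sum g (carrier G)"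
proof -
  let ?T = "carrier G - insert \<one> S"
  have "(\<Sum>v\<in>carrier G. sum g (carrier G - closed_nbhd (Cay S G) v))
      = (\<Sum>v\<in>carrier G. \<Sum>t\<in>?T. g (inv t \<otimes> v))"
    by (rule sum.cong[OF refl])
      (simp only: Diff_closed_nbhd_Cay sum.reindex[OF inj_on_inv_mult] Diff_subset o_def)
  also have "\<dots> = (\<Sum>t\<in>?T. \<Sum>v\<in>carrier G. g (inv t \<otimes> v))" by (rule sum.swap)
  also have "\<dots> = (\<Sum>t\<in>?T. sum g (carrier G))"
  proof (rule sum.cong[OF refl])
    fix t assume t: "t \<in> ?T"
    show "(\<Sum>v\<in>carrier G. g (inv t \<otimes> v)) = sum g (carrier G)"
      using t by (intro sum.reindex_bij_witness[of _ "\<lambda>v. t \<otimes> v" "\<lambda>v. inv t \<otimes> v"])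
        (auto simp: m_assoc[symmetric])
  qed
  finally show ?thesis by simp
qed

theorem theorem2p5:
  fixes G :: "('a, 'b) monoid_scheme" and S :: "'a set" and n :: nat
  assumes "group G" and "finite (carrier G)" and "order G = n"
    and "S \<subseteq> carrier G - {\<one>\<^bsub>G\<^esub>}" and "S = set_inv\<^bsub>G\<^esub> S"
    and "carrier G = generate G S"
    and "int (card S) = int n - 3"
  shows "(odd n \<longrightarrow> signed_domination_number (Cay S G) = 3) \<and>
         (even n \<longrightarrow> signed_domination_number (Cay S G) = 4)"
proof -
  interpret group G by fact
  let ?\<Gamma> = "Cay S G" and ?A = "carrier G"
  let ?d = "\<lambda>g v. sum g (?A - closed_nbhd ?\<Gamma> v) :: int"
  have verts: "pverts ?\<Gamma> = ?A" by (simp add: Cay_def)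
  have card_A: "card ?A = n" using assms(3) by (simp add: order_def)
  \<comment> \<open>The cardinality equation is over the integers, so it is
    \<open>card S \<ge> 0\<close> that gives the bound.\<close>
  have n3: "n \<ge> 3" using assms(7) by linarith
  have "finite S" "\<one>\<^bsub>G\<^esub> \<notin> S" "insert \<one>\<^bsub>G\<^esub> S \<subseteq> ?A"
    using assms(2,4) by (auto intro: finite_subset)
  then have card_T: "card (?A - insert \<one>\<^bsub>G\<^esub> S) = 2"
    using assms(7) card_A by (simp add: card_Diff_subset)
  \<comment> \<open>Splitting the weight over N[v] and its complement turns positivity on N[v] into
    an upper bound for the two-element sum \<open>?d g v\<close>.\<close>
  have dominating_iff: "signed_dominating ?\<Gamma> g
      \<longleftrightarrow> g \<in> ?A \<rightarrow>\<^sub>E {-1, 1} \<and> (\<forall>v\<in>?A. ?d g v < weight ?\<Gamma> g)" for g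
  proof -
    have "sum g ?A = ?d g v + sum g (closed_nbhd ?\<Gamma> v)" if "v \<in> ?A" for v
      using assms(2) that by (intro sum.subset_diff) (auto simp: closed_nbhd_def verts)
    then show ?thesis by (auto simp: signed_dominating_def weight_def verts)
  qed
  have parity: "even (weight ?\<Gamma> g) \<longleftrightarrow> even n" if "g \<in> ?A \<rightarrow>\<^sub>E {-1, 1}" for g
    using even_sum_signs_iff[OF assms(2), of g] that card_A
    by (auto simp: weight_def verts PiE_def)
  have lower: "weight ?\<Gamma> g \<ge> 3" if g: "signed_dominating ?\<Gamma> g" for g
  proof (rule ccontr)
    let ?w = "weight ?\<Gamma> g"
    assume "\<not> ?w \<ge> 3"
    have d_less: "?d g v < ?w" if "v \<in> ?A" for v using g that dominating_iff by blast
    have d_sum: "(\<Sum>v\<in>?A. ?d g v) = 2 * ?w"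
      by (simp add: sum_sum_Diff_closed_nbhd_Cay card_T weight_def verts)
    have "?d g v \<le> 0" if v: "v \<in> ?A" for v
    proof -
      have "g \<in> ?A - closed_nbhd ?\<Gamma> v \<rightarrow> {-1, 1}" using g dominating_iff by auto
      then have "even (?d g v)"
        using even_sum_signs_iff[of "?A - closed_nbhd ?\<Gamma> v" g] assms(2)
        by (simp add: card_Diff_closed_nbhd_Cay[OF v] card_T)
      moreover have "?d g v < 2" using d_less[OF v] \<open>\<not> ?w \<ge> 3\<close> by linarith
      ultimately show ?thesis by presburger
    qed
    then have "(\<Sum>v\<in>?A. ?d g v) \<le> 0" by (rule sum_nonpos)
    then have "?w \<le> 0" using d_sum by simp
    \<comment> \<open>Strict inequality between integers gains 1 at each of the \<open>n\<close>
      vertices.\<close>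
    have "(\<Sum>v\<in>?A. ?d g v) \<le> (\<Sum>v\<in>?A. ?w - 1)"
      using d_less by (intro sum_mono) force
    then have "2 * ?w \<le> int n * (?w - 1)" using d_sum card_A by simp
    \<comment> \<open>The factor \<open>?w - 1\<close> is negative, so lowering \<open>n\<close> to
      3 can only raise the product.\<close>
    also have "\<dots> \<le> 3 * (?w - 1)"
      using n3 \<open>?w \<le> 0\<close> by (intro mult_right_mono_neg) auto
    finally show False using \<open>?w \<le> 0\<close> by simp
  qed
  have attained: "\<exists>g. signed_dominating ?\<Gamma> g \<and> weight ?\<Gamma> g = int k"
    if k: "3 \<le> k" "k \<le> n" "even (n - k)" for k
  proof -
    obtain g where g: "g \<in> ?A \<rightarrow>\<^sub>E {-1, 1}" "sum g ?A = int k"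
      using ex_signs_with_sum[OF assms(2), of k] k card_A by auto
    \<comment> \<open>Two values, each at most 1, sum to at most 2 < k, wherever the -1's are
      placed.\<close>
    have "?d g v < int k" if v: "v \<in> ?A" for v
    proof -
      have "?d g v \<le> (\<Sum>u\<in>?A - closed_nbhd ?\<Gamma> v. 1)"
      proof (rule sum_mono)
        fix u assume "u \<in> ?A - closed_nbhd ?\<Gamma> v"
        then have "g u \<in> {-1, 1}" using g(1) by blast
        then show "g u \<le> 1" by auto
      qed
      also have "\<dots> = 2" by (simp add: card_Diff_closed_nbhd_Cay[OF v] card_T)
      finally show ?thesis using k(1) by simp
    qed
    then show ?thesis using g dominating_iff by (auto simp: weight_def verts)
  qed
  have fin: "finite {weight ?\<Gamma> g | g. signed_dominating ?\<Gamma> g}"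
    using assms(2) by (intro finite_signed_dominating) (simp add: verts)
  show ?thesis
  proof (intro conjI impI)
    assume "odd n"
    then have "\<exists>g. signed_dominating ?\<Gamma> g \<and> weight ?\<Gamma> g = 3"
      using attained[of 3] n3 by simp
    then show "signed_domination_number ?\<Gamma> = 3"
      unfolding signed_domination_number_def using lower by (intro Min_eqI[OF fin]) force+
  next
    assume "even n"
    \<comment> \<open>Weight 4 needs at least four vertices; evenness excludes n = 3.\<close>
    then have "n \<ge> 4" using n3 by presburger
    then have "\<exists>g. signed_dominating ?\<Gamma> g \<and> weight ?\<Gamma> g = 4"
      using attained[of 4] \<open>even n\<close> by simp
    \<comment> \<open>Parity rules out the value 3 left open by \<open>lower\<close>.\<close>
    moreover have "weight ?\<Gamma> g \<ge> 4" if "signed_dominating ?\<Gamma> g" for g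
    proof -
      have "even (weight ?\<Gamma> g)" using parity that dominating_iff \<open>even n\<close> by blast
      then show ?thesis using lower[OF that] by presburger
    qed
    ultimately show "signed_domination_number ?\<Gamma> = 4"
      unfolding signed_domination_number_def by (intro Min_eqI[OF fin]) force+
  qed
qed

end
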